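(* Let $D=(V,A)$ be a finite digraph and $Q=\{B\subseteq A: D[B]\text{ is totally cyclic}\}$ ordered by inclusion. Then $$\psi_{NL}^D(x)=\sum_{B\in Q}(-1)^{rk_Q(B)}x^{rk(A/B)}.$$
   Context: Digraphs may have loops, parallel and antiparallel arcs. $D[B]$ is the subdigraph formed by the arcs of $B$ and their ends; it is totally cyclic if each of its (weakly) connected components is strongly connected ($\emptyset\in Q$). $rk_Q(B)$ is the maximum length $r$ of a chain $\emptyset=B_0\subsetneq B_1\subsetneq\dots\subsetneq B_r=B$ in $Q$. $A/B$ is the digraph obtained from $D$ by contracting the arcs of $B$, and for a digraph $Y$, $rk(Y)$ is its number of vertices minus its number of (weakly) connected components. Definition of $\psi_{NL}^D$: let $\mathcal U$ be the set of arc sets $C\subseteq A$ that are unions of arc sets of finitely many directed cycles of $D$ (including $\emptyset$); let $\mathcal C=\{A/C: C\in\mathcal U\}$ ordered by $A/C'\le A/C$ iff $C\subseteq C'$; let $\mu(A,Y)$ be the Möbius function value on the interval from $Y$ up to $A$ in this poset (equivalently $\mu(A,A/C)=\mu_{\mathcal U}(\emptyset,C)$ for the Möbius function of $\mathcal U$ ordered by inclusion). Then $\psi_{NL}^D(x)=\sum_{Y\in\mathcal C}\mu(A,Y)x^{rk(Y)}$. *)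

theory Defs
  imports
    "Graph_Theory.Digraph_Component"
    "HOL-Computational_Algebra.Polynomial"
begin

section \<open>Moebius function of a finite poset\<close>

text \<open>
  The poset is given by a carrier and a relation, with \<open>(a, b) \<in> le\<close> meaning that \<open>a\<close> is below
  \<open>b\<close>. The value is 0 outside the incidence relation, and also if the data is not a finite poset;
  the latter guard only serves termination.
\<close>

function moebius :: "'a set \<Rightarrow> 'a rel \<Rightarrow> 'a \<Rightarrow> 'a \<Rightarrow> int" where
  "moebius P le a b =
     (if finite P \<and> partial_order_on P le \<and> (a, b) \<in> le then
        if a = b then 1
        else - (\<Sum>z \<in> {z \<in> P. (a, z) \<in> le \<and> (z, b) \<in> le \<and> z \<noteq> b}. moebius P le a z)
      else 0)"
  by pat_completeness auto
termination
proof (relation "measure (\<lambda>(P, le, a, b). card {z \<in> P. (a, z) \<in> le \<and> (z, b) \<in> le})", goal_cases)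
  case 1
  show ?case by simp
next
  case (2 P le a b z)
  then have fin: "finite P" and po: "partial_order_on P le" and ab: "(a, b) \<in> le"
    and z: "(a, z) \<in> le" "(z, b) \<in> le" "z \<noteq> b"
    by auto
  have "trans le" "antisym le" "refl_on P le" "le \<subseteq> P \<times> P"
    using po by (auto simp: partial_order_on_def preorder_on_def)
  note ord = this
  let ?I = "\<lambda>b. {w \<in> P. (a, w) \<in> le \<and> (w, b) \<in> le}"
  have "?I z \<subseteq> ?I b"
    using z ord by (auto dest: transD)
  moreover have "b \<in> ?I b" "b \<notin> ?I z"
    using z ab ord by (auto dest: refl_onD antisymD)
  ultimately have "?I z \<subset> ?I b" by blast
  then show ?case
    using fin by (simp add: psubset_card_mono)
qed

declare moebius.simps [simp del]


section \<open>Weak components, rank and contraction\<close>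

definition weak_components :: "('a, 'b) pre_digraph \<Rightarrow> ('a, 'b) pre_digraph set" where
  "weak_components G = {H. pre_digraph.max_subgraph G connected H}"

definition digraph_rk :: "('a, 'b) pre_digraph \<Rightarrow> nat" where
  "digraph_rk G = card (verts G) - card (weak_components G)"

definition weak_class :: "('a, 'b) pre_digraph \<Rightarrow> 'a \<Rightarrow> 'a set" where
  "weak_class G v = {w. v \<rightarrow>\<^sup>*\<^bsub>with_proj (mk_symmetric G)\<^esub> w}"

text \<open>
  The contracted arcs disappear, every other arc is kept (possibly as a loop), and two vertices are
  identified iff they lie in the same weak component of the spanning subdigraph with arc set \<open>B\<close>.
  In particular the contraction by the empty set is \<open>D\<close> with each vertex \<open>v\<close> renamed to \<open>{v}\<close>.
\<close>

definition contract :: "('a, 'b) pre_digraph \<Rightarrow> 'b set \<Rightarrow> ('a set, 'b) pre_digraph" where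
  "contract D B =
     \<lparr> verts = weak_class (D\<lparr>arcs := B\<rparr>) ` verts D,
       arcs = arcs D - B,
       tail = (\<lambda>e. weak_class (D\<lparr>arcs := B\<rparr>) (tail D e)),
       head = (\<lambda>e. weak_class (D\<lparr>arcs := B\<rparr>) (head D e)) \<rparr>"


section \<open>The polynomial \<open>\<psi>\<^sub>N\<^sub>L\<close>\<close>

definition cycle_unions :: "('a, 'b) pre_digraph \<Rightarrow> 'b set set" where
  "cycle_unions D = {\<Union> (set ` S) | S. finite S \<and> (\<forall>p \<in> S. pre_digraph.cycle D p)}"

definition cycle_contractions :: "('a, 'b) pre_digraph \<Rightarrow> ('a set, 'b) pre_digraph set" where
  "cycle_contractions D = contract D ` cycle_unions D"

definition cycle_contraction_order :: "('a, 'b) pre_digraph \<Rightarrow> ('a set, 'b) pre_digraph rel" where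
  "cycle_contraction_order D =
     {(contract D C', contract D C) | C C'. C \<in> cycle_unions D \<and> C' \<in> cycle_unions D \<and> C \<subseteq> C'}"

text \<open>
  The top element of the poset, the digraph itself, is \<open>contract D {}\<close>.
\<close>

definition psi_NL :: "('a, 'b) pre_digraph \<Rightarrow> int poly" where
  "psi_NL D = (\<Sum>Y \<in> cycle_contractions D.
     monom (moebius (cycle_contractions D) (cycle_contraction_order D) Y (contract D {}))
       (digraph_rk Y))"


section \<open>Totally cyclic subdigraphs\<close>

definition arc_subdigraph :: "('a, 'b) pre_digraph \<Rightarrow> 'b set \<Rightarrow> ('a, 'b) pre_digraph" where
  "arc_subdigraph D B = D\<lparr>verts := tail D ` B \<union> head D ` B, arcs := B\<rparr>"

definition totally_cyclic :: "('a, 'b) pre_digraph \<Rightarrow> bool" where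
  "totally_cyclic G \<longleftrightarrow> (\<forall>H \<in> weak_components G. strongly_connected H)"

definition totally_cyclic_sets :: "('a, 'b) pre_digraph \<Rightarrow> 'b set set" where
  "totally_cyclic_sets D = {B. B \<subseteq> arcs D \<and> totally_cyclic (arc_subdigraph D B)}"

definition rk_Q :: "('a, 'b) pre_digraph \<Rightarrow> 'b set \<Rightarrow> nat" where
  "rk_Q D B = Max {r. \<exists>c :: nat \<Rightarrow> 'b set. c 0 = {} \<and> c r = B \<and>
     (\<forall>i \<le> r. c i \<in> totally_cyclic_sets D) \<and> (\<forall>i < r. c i \<subset> c (Suc i))}"


section \<open>The definitions above are applied to well-formed data\<close>

lemma cycle_unions_subset: "C \<in> cycle_unions D \<Longrightarrow> C \<subseteq> arcs D"
  by (fastforce simp: cycle_unions_def pre_digraph.cycle_def pre_digraph.awalk_def)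

lemma empty_in_cycle_unions: "{} \<in> cycle_unions D"
  unfolding cycle_unions_def by (rule CollectI, rule exI[of _ "{}"]) simp

lemma inj_on_contract: "inj_on (contract D) (cycle_unions D)"
proof (rule inj_onI)
  fix C C' assume C: "C \<in> cycle_unions D" "C' \<in> cycle_unions D" and eq: "contract D C = contract D C'"
  have "arcs D - C = arcs D - C'"
    using arg_cong[OF eq, of arcs] by (simp add: contract_def)
  then show "C = C'"
    using cycle_unions_subset[OF C(1)] cycle_unions_subset[OF C(2)] by blast
qed

lemma partial_order_on_cycle_contractions:
  "partial_order_on (cycle_contractions D) (cycle_contraction_order D)"
proof -
  note inj = inj_onD[OF inj_on_contract[of D]]
  have "trans (cycle_contraction_order D)"
  proof (rule transI)
    fix x y z assume "(x, y) \<in> cycle_contraction_order D" "(y, z) \<in> cycle_contraction_order D"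
    then obtain C1 C2 C3 C4 where
      "x = contract D C1" "y = contract D C2" "y = contract D C3" "z = contract D C4"
      "C2 \<subseteq> C1" "C4 \<subseteq> C3" "C1 \<in> cycle_unions D" "C2 \<in> cycle_unions D" "C3 \<in> cycle_unions D"
      "C4 \<in> cycle_unions D"
      unfolding cycle_contraction_order_def by blast
    moreover from this have "C2 = C3" using inj by metis
    ultimately show "(x, z) \<in> cycle_contraction_order D"
      unfolding cycle_contraction_order_def by blast
  qed
  moreover have "antisym (cycle_contraction_order D)"
  proof (rule antisymI)
    fix x y assume "(x, y) \<in> cycle_contraction_order D" "(y, x) \<in> cycle_contraction_order D"
    then obtain C1 C2 C3 C4 where
      "x = contract D C1" "y = contract D C2" "y = contract D C3" "x = contract D C4"
      "C2 \<subseteq> C1" "C4 \<subseteq> C3" "C1 \<in> cycle_unions D" "C2 \<in> cycle_unions D" "C3 \<in> cycle_unions D"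
      "C4 \<in> cycle_unions D"
      unfolding cycle_contraction_order_def by blast
    moreover from this have "C2 = C3" "C1 = C4" using inj by metis+
    ultimately show "x = y" by auto
  qed
  ultimately show ?thesis
    by (auto simp: partial_order_on_def preorder_on_def refl_on_def cycle_contractions_def
        cycle_contraction_order_def)
qed

lemma finite_cycle_contractions:
  assumes "fin_digraph D"
  shows "finite (cycle_contractions D)"
proof -
  have "cycle_unions D \<subseteq> Pow (arcs D)"
    using cycle_unions_subset by blast
  then show ?thesis
    unfolding cycle_contractions_def
    using fin_digraph.finite_arcs[OF assms] finite_subset by blast
qed

end

theory Submission
  imports Defs
begin

text \<open>
  To a relation \<open>R\<close> on \<open>V\<close> belongs the cone \<open>K R\<close> of all real vectors \<open>x\<close> indexed by \<open>V\<close> with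
  \<open>x u \<le> x v\<close> for \<open>(u, v) \<in> R\<close>. Its Euler characteristic \<open>\<chi>\<close> with compact supports is a sign if
  \<open>R\<close> is totally cyclic, which amounts to \<open>sym (R\<^sup>*)\<close> and makes \<open>K R\<close> a linear space, and 0
  otherwise. For totally cyclic arc sets \<open>Z \<subset> C\<close> no \<open>x\<close> satisfies \<open>x u \<le> x v\<close> on the arcs of
  \<open>Z\<close> and \<open>x u > x v\<close> on those of \<open>C - Z\<close>: it would be constant along the arcs of \<open>Z\<close>, and so it
  would return to a smaller value along a directed cycle of \<open>C\<close> through an arc of \<open>C - Z\<close>. By
  inclusion and exclusion, the Euler characteristic of this empty set is an alternating sum over the
  interval from \<open>Z\<close> to \<open>C\<close>, so the signs \<open>(-1)\<^bsup>|B|\<^esup> \<chi> (K B)\<close> sum to 0 over every interval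
  of \<open>Q\<close>. Hence products of two of them are the values of the Moebius function, and they alternate
  along every saturated chain, in particular along one whose length is the rank.
\<close>

section \<open>Signs that sum to zero over intervals\<close>

lemma moebius_eq_sign_mult:
  assumes "finite P" "partial_order_on P le"
    and "\<And>z. z \<in> P \<Longrightarrow> s z * s z = 1"
    and "\<And>a b. (a, b) \<in> le \<Longrightarrow> a \<noteq> b \<Longrightarrow> (\<Sum>z \<in> {z \<in> P. (a, z) \<in> le \<and> (z, b) \<in> le}. s z) = 0"
    and "(a, b) \<in> le"
  shows "moebius P le a b = s a * s b"
  using assms
proof (induction P le a b rule: moebius.induct)
  case (1 P le a b)
  note fin = "1.prems"(1) and po = "1.prems"(2) and square = "1.prems"(3)
    and interval_sum = "1.prems"(4) and ab = "1.prems"(5)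
  have "a \<in> P" "b \<in> P" "(b, b) \<in> le"
    using po ab by (auto simp: partial_order_on_def preorder_on_def refl_on_def)
  show ?case
  proof (cases "a = b")
    case True
    then show ?thesis using fin po ab square \<open>a \<in> P\<close> by (simp add: moebius.simps)
  next
    case False
    let ?I = "{z \<in> P. (a, z) \<in> le \<and> (z, b) \<in> le}"
    have "{z \<in> P. (a, z) \<in> le \<and> (z, b) \<in> le \<and> z \<noteq> b} = ?I - {b}" by auto
    then have "moebius P le a b = - (\<Sum>z \<in> ?I - {b}. moebius P le a z)"
      using fin po ab False by (subst moebius.simps) simp
    also have "(\<Sum>z \<in> ?I - {b}. moebius P le a z) = (\<Sum>z \<in> ?I - {b}. s a * s z)"
      by (rule sum.cong) (use 1 False in auto)
    also have "\<dots> = s a * (sum s ?I - s b)"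
      using fin ab \<open>b \<in> P\<close> \<open>(b, b) \<in> le\<close> by (simp add: sum_diff1 flip: sum_distrib_left)
    finally show ?thesis using interval_sum[OF ab False] by simp
  qed
qed

definition eulerian_sign :: "'a set set \<Rightarrow> ('a set \<Rightarrow> int) \<Rightarrow> bool" where
  "eulerian_sign Q s \<longleftrightarrow> (\<forall>B \<in> Q. s B * s B = 1) \<and>
     (\<forall>Z \<in> Q. \<forall>C \<in> Q. Z \<subset> C \<longrightarrow> (\<Sum>B \<in> {B \<in> Q. Z \<subseteq> B \<and> B \<subseteq> C}. s B) = 0)"

lemma eulerian_sign_cover:
  assumes "eulerian_sign Q s" "Z \<in> Q" "C \<in> Q" "Z \<subset> C" "\<not> (\<exists>B \<in> Q. Z \<subset> B \<and> B \<subset> C)"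
  shows "s C = - s Z"
proof -
  have "{B \<in> Q. Z \<subseteq> B \<and> B \<subseteq> C} = {Z, C}" using assms(2-5) by blast
  moreover have "(\<Sum>B \<in> {B \<in> Q. Z \<subseteq> B \<and> B \<subseteq> C}. s B) = 0"
    using assms(1-4) by (simp add: eulerian_sign_def)
  ultimately show ?thesis using assms(4) by simp
qed

definition set_chain :: "'a set set \<Rightarrow> nat \<Rightarrow> (nat \<Rightarrow> 'a set) \<Rightarrow> bool" where
  "set_chain Q r c \<longleftrightarrow> (\<forall>i \<le> r. c i \<in> Q) \<and> (\<forall>i < r. c i \<subset> c (Suc i))"

lemma set_chain_length_le_card:
  assumes "set_chain Q r c" "finite (c r)"
  shows "r \<le> card (c r)"
  using assms
proof (induction r)
  case (Suc r)
  then have "c r \<subset> c (Suc r)" by (simp add: set_chain_def)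
  then have "card (c r) < card (c (Suc r))" "finite (c r)"
    using Suc.prems(2) by (auto simp: psubset_card_mono intro: finite_subset)
  moreover have "set_chain Q r c" using Suc.prems(1) by (simp add: set_chain_def)
  ultimately show ?case using Suc.IH by simp
qed simp

lemma set_chain_insert:
  assumes "set_chain Q r c" "i < r" "X \<in> Q" "c i \<subset> X" "X \<subset> c (Suc i)"
  shows "set_chain Q (Suc r) (\<lambda>j. if j \<le> i then c j else if j = Suc i then X else c (j - 1))"
    (is "set_chain _ _ ?d")
  unfolding set_chain_def
proof (intro conjI allI impI)
  fix j assume "j < Suc r"
  then consider "j < i" | "j = i" | "j = Suc i" | k where "j = Suc k" "i < k" "k < r"
    by (cases j) force+
  then show "?d j \<subset> ?d (Suc j)"
    using assms by cases (auto simp: set_chain_def)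
qed (use assms in \<open>auto simp: set_chain_def\<close>)

lemma eulerian_sign_longest_chain:
  assumes "eulerian_sign Q s" "set_chain Q r c"
    and longest: "\<And>d k. set_chain Q k d \<Longrightarrow> d 0 = c 0 \<Longrightarrow> d k = c r \<Longrightarrow> k \<le> r"
  shows "s (c r) = (-1) ^ r * s (c 0)"
proof -
  have "s (c i) = (-1) ^ i * s (c 0)" if "i \<le> r" for i
    using that
  proof (induction i)
    case (Suc i)
    have "\<not> (\<exists>X \<in> Q. c i \<subset> X \<and> X \<subset> c (Suc i))"
    proof
      assume "\<exists>X \<in> Q. c i \<subset> X \<and> X \<subset> c (Suc i)"
      then obtain X where "X \<in> Q" "c i \<subset> X" "X \<subset> c (Suc i)" by blast
      from longest[OF set_chain_insert[OF assms(2) Suc_le_lessD[OF Suc.prems] this]] Suc.prems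
      show False by auto
    qed
    then have "s (c (Suc i)) = - s (c i)"
      using assms(2) Suc.prems
      by (intro eulerian_sign_cover[OF assms(1)]) (auto simp: set_chain_def)
    then show ?case using Suc by simp
  qed simp
  from this[OF order_refl] show ?thesis .
qed

section \<open>The Euler characteristic of an order cone\<close>

lemma sym_rtrancl_iff: "sym (R\<^sup>*) \<longleftrightarrow> R\<inverse> \<subseteq> R\<^sup>*"
proof
  assume "R\<inverse> \<subseteq> R\<^sup>*"
  then have "(R\<^sup>*)\<inverse> \<subseteq> R\<^sup>*"
    using rtrancl_subset_rtrancl by (simp add: rtrancl_converse[symmetric])
  then show "sym (R\<^sup>*)" by (auto simp: sym_def)
qed (auto simp: sym_def)

lemma sym_rtrancl_Union:
  assumes "\<And>R. R \<in> \<R> \<Longrightarrow> sym (R\<^sup>*)"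
  shows "sym ((\<Union>\<R>)\<^sup>*)"
  unfolding sym_rtrancl_iff
proof (rule subrelI)
  fix x y assume "(x, y) \<in> (\<Union>\<R>)\<inverse>"
  then obtain R where R: "R \<in> \<R>" "(x, y) \<in> R\<inverse>" by blast
  then have "(x, y) \<in> R\<^sup>*" using assms[OF R(1)] unfolding sym_rtrancl_iff by blast
  then show "(x, y) \<in> (\<Union>\<R>)\<^sup>*" using rtrancl_mono[of R "\<Union>\<R>"] R(1) by blast
qed

lemma rtrancl_insert_absorb:
  "(u, v) \<in> R\<^sup>* \<Longrightarrow> (insert (u, v) R)\<^sup>* = R\<^sup>*"
  unfolding rtrancl_insert by (auto intro: rtrancl_trans)

lemma not_sym_rtrancl_insert:
  assumes "(u, v) \<notin> R\<^sup>*" "(v, u) \<notin> R\<^sup>*"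
  shows "\<not> sym ((insert (u, v) R)\<^sup>*)"
proof
  assume "sym ((insert (u, v) R)\<^sup>*)"
  moreover have "(u, v) \<in> (insert (u, v) R)\<^sup>*" by auto
  ultimately have "(v, u) \<in> (insert (u, v) R)\<^sup>*" by (rule symD)
  then show False using assms by (auto simp: rtrancl_insert)
qed

lemma rtrancl_insert_antiparallel:
  assumes "sym (R\<^sup>*)"
  shows "(insert (u, v) (insert (v, u) R))\<^sup>* = R\<^sup>* \<union> R\<^sup>* `` {u, v} \<times> R\<^sup>* `` {u, v}"
  using symD[OF assms] unfolding rtrancl_insert by (auto intro: rtrancl_trans)

lemma sym_rtrancl_insert_antiparallel_iff:
  assumes "(u, v) \<notin> R\<^sup>*" "(v, u) \<notin> R\<^sup>*"
  shows "sym ((insert (u, v) (insert (v, u) R))\<^sup>*) \<longleftrightarrow> sym (R\<^sup>*)"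
    (is "sym (?S\<^sup>*) \<longleftrightarrow> _")
proof
  assume "sym (R\<^sup>*)"
  then show "sym (?S\<^sup>*)" by (auto simp: rtrancl_insert_antiparallel sym_def)
next
  assume S: "sym (?S\<^sup>*)"
  show "sym (R\<^sup>*)"
    unfolding sym_rtrancl_iff
  proof (rule subrelI)
    fix y x assume "(y, x) \<in> R\<inverse>"
    then have xy: "(x, y) \<in> R" by simp
    then have "(x, y) \<in> ?S\<^sup>*" by blast
    then have "(y, x) \<in> ?S\<^sup>*" by (rule symD[OF S])
    \<comment> \<open>A return path from \<open>y\<close> to \<open>x\<close> that needs a new arc joins \<open>u\<close> and \<open>v\<close> via \<open>(x, y)\<close>.\<close>
    moreover have "(b, a) \<in> R\<^sup>*" if "(y, a) \<in> R\<^sup>*" "(b, x) \<in> R\<^sup>*" for a b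
      using that xy by (meson rtrancl_into_rtrancl rtrancl_trans)
    ultimately show "(y, x) \<in> R\<^sup>*"
      using assms unfolding rtrancl_insert by (auto intro: rtrancl_trans)
  qed
qed

lemma card_quotient_merge:
  assumes "equiv UNIV E" "finite V" "u \<in> V" "v \<in> V" "(u, v) \<notin> E"
  shows "card (V // E) = Suc (card (V // (E \<union> E `` {u, v} \<times> E `` {u, v})))"
proof -
  let ?U = "E `` {u, v}" and ?E' = "E \<union> E `` {u, v} \<times> E `` {u, v}"
  let ?T = "{E `` {u}, E `` {v}}"
  have class_eq: "E `` {x} = E `` {y} \<longleftrightarrow> (x, y) \<in> E" for x y
    using eq_equiv_class_iff[OF assms(1)] by simp
  have in_U: "x \<in> ?U \<longleftrightarrow> E `` {x} \<in> ?T" for x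
    using class_eq[of u x] class_eq[of v x] by auto
  have u_v_classes: "?T \<subseteq> V // E" "card ?T = 2"
    using assms(3-5) class_eq[of u v] by (auto intro: quotientI)
  have "?E' `` {x} = (if E `` {x} \<in> ?T then ?U else E `` {x})" for x
    unfolding in_U[symmetric] using class_eq[of u x] class_eq[of v x] by auto
  then have "V // ?E' = (\<lambda>X. if X \<in> ?T then ?U else X) ` (V // E)"
    by (simp only: quotient_def UNION_singleton_eq_range image_image)
  also have "\<dots> = insert ?U (V // E - ?T)" using u_v_classes(1) by auto
  finally have merged: "V // ?E' = insert ?U (V // E - ?T)" .
  have "?U \<notin> V // E"
  proof
    assume "?U \<in> V // E"
    then obtain x where "?U = E `` {x}" by (rule quotientE)
    then have "(x, u) \<in> E" "(x, v) \<in> E" using in_U[of u] in_U[of v] by auto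
    then show False using assms(5) class_eq by metis
  qed
  moreover have "finite (V // E)" using assms(2) by (simp add: quotient_def)
  ultimately show ?thesis
    unfolding merged
    using u_v_classes card_Diff_subset[of ?T "V // E"] card_mono[of "V // E" ?T] by simp
qed

definition cone_euler :: "'v set \<Rightarrow> 'v rel \<Rightarrow> int" where
  "cone_euler V R = (if sym (R\<^sup>*) then (-1) ^ card (V // R\<^sup>*) else 0)"

text \<open>
  The cones of \<open>insert (u, v) R\<close> and \<open>insert (v, u) R\<close> cover that of \<open>R\<close>, so the identity says that
  \<open>cone_euler\<close> is a valuation. No other property of Euler characteristics is needed.
\<close>

lemma cone_euler_four_term:
  assumes "finite V" "u \<in> V" "v \<in> V"
  shows "cone_euler V R + cone_euler V (insert (u, v) (insert (v, u) R)) =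
    cone_euler V (insert (u, v) R) + cone_euler V (insert (v, u) R)"
proof -
  consider (forward) "(u, v) \<in> R\<^sup>*" | (backward) "(v, u) \<in> R\<^sup>*"
    | (incomparable) "(u, v) \<notin> R\<^sup>*" "(v, u) \<notin> R\<^sup>*" by blast
  then show ?thesis
  proof cases
    case forward
    then have "(u, v) \<in> (insert (v, u) R)\<^sup>*" using rtrancl_mono[of R "insert (v, u) R"] by blast
    then show ?thesis using forward by (simp add: cone_euler_def rtrancl_insert_absorb)
  next
    case backward
    then have "(v, u) \<in> (insert (u, v) R)\<^sup>*" using rtrancl_mono[of R "insert (u, v) R"] by blast
    then show ?thesis
      using backward by (simp add: cone_euler_def rtrancl_insert_absorb insert_commute[of "(u, v)"])
  next
    case incomparable
    have "cone_euler V (insert (u, v) (insert (v, u) R)) = - cone_euler V R"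
    proof (cases "sym (R\<^sup>*)")
      case True
      then have "equiv UNIV (R\<^sup>*)" by (simp add: equiv_def refl_rtrancl trans_rtrancl)
      from card_quotient_merge[OF this assms] incomparable(1) show ?thesis
        using True sym_rtrancl_insert_antiparallel_iff[OF incomparable]
        by (simp add: cone_euler_def rtrancl_insert_antiparallel)
    qed (use sym_rtrancl_insert_antiparallel_iff[OF incomparable] in \<open>simp add: cone_euler_def\<close>)
    then show ?thesis
      using not_sym_rtrancl_insert[of u v R] not_sym_rtrancl_insert[of v u R] incomparable
      by (simp add: cone_euler_def)
  qed
qed

text \<open>
  By inclusion and exclusion, this is the Euler characteristic of the set of all \<open>x\<close> with
  \<open>x u \<le> x v\<close> for \<open>(u, v) \<in> F\<close> and \<open>x u > x v\<close> for the ends \<open>(u, v)\<close> of the arcs in \<open>A\<close>.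
\<close>

definition half_open_cone_euler :: "'v set \<Rightarrow> ('b \<Rightarrow> 'v \<times> 'v) \<Rightarrow> 'v rel \<Rightarrow> 'b set \<Rightarrow> int" where
  "half_open_cone_euler V p F A = (\<Sum>X \<in> Pow A. (-1) ^ card X * cone_euler V (p ` X \<union> F))"

lemma half_open_cone_euler_four_term:
  assumes "finite V" "u \<in> V" "v \<in> V"
  shows "half_open_cone_euler V p F A +
      half_open_cone_euler V p (insert (u, v) (insert (v, u) F)) A =
    half_open_cone_euler V p (insert (u, v) F) A + half_open_cone_euler V p (insert (v, u) F) A"
  unfolding half_open_cone_euler_def Un_insert_right
  by (simp only: cone_euler_four_term[OF assms] sum.distrib[symmetric] distrib_left[symmetric])

lemma half_open_cone_euler_eq_0_if_implied:
  assumes "finite A" "e \<in> A" "p e \<in> F\<^sup>*"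
  shows "half_open_cone_euler V p F A = 0"
proof -
  define A' where "A' = A - {e}"
  have A_eq: "A = insert e A'" and A': "e \<notin> A'" "finite A'" using assms(1,2) by (auto simp: A'_def)
  have cancel: "(-1) ^ card (insert e X) * cone_euler V (p ` insert e X \<union> F) =
      - ((-1) ^ card X * cone_euler V (p ` X \<union> F))" if "X \<in> Pow A'" for X
  proof -
    have "p e \<in> (p ` X \<union> F)\<^sup>*" using assms(3) rtrancl_mono[of F "p ` X \<union> F"] by blast
    then have "cone_euler V (p ` insert e X \<union> F) = cone_euler V (p ` X \<union> F)"
      using rtrancl_insert_absorb[of "fst (p e)" "snd (p e)" "p ` X \<union> F"]
      by (simp add: cone_euler_def)
    moreover have "e \<notin> X" "finite X" using that A' finite_subset by auto
    ultimately show ?thesis by simp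
  qed
  have "inj_on (insert e) (Pow A')" using A'(1) by (auto intro!: inj_onI)
  moreover have "Pow A' \<inter> insert e ` Pow A' = {}" using A'(1) by auto
  ultimately show ?thesis
    unfolding half_open_cone_euler_def A_eq Pow_insert
    using A'(2) by (simp add: sum.union_disjoint sum.reindex cancel sum_negf del: image_insert)
qed

lemma total_rtrancl_meets_if_infeasible:
  assumes "R \<subseteq> V \<times> V" "\<forall>x \<in> V. \<forall>y \<in> V. (x, y) \<in> F\<^sup>* \<or> (y, x) \<in> F\<^sup>*"
    and "(u, v) \<in> R" "(u, v) \<in> (F \<union> R\<inverse>)\<^sup>*"
  shows "R \<inter> F\<^sup>* \<noteq> {}"
proof
  assume disjoint: "R \<inter> F\<^sup>* = {}"
  then have "R\<inverse> \<subseteq> F\<^sup>*" using assms(1,2) by blast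
  then have "(F \<union> R\<inverse>)\<^sup>* \<subseteq> F\<^sup>*" by (intro rtrancl_subset_rtrancl) auto
  then show False using assms(3,4) disjoint by blast
qed

text \<open>
  The hypothesis on \<open>(u, v)\<close> is a certificate that the half-open cone is empty. The four-term
  relation reduces the claim to the case that \<open>F\<close> decides all comparisons.
\<close>

lemma half_open_cone_euler_eq_0_if_infeasible:
  assumes "finite V" "finite A" "p ` A \<subseteq> V \<times> V"
    and "(u, v) \<in> p ` A" "(u, v) \<in> (F \<union> (p ` A)\<inverse>)\<^sup>*"
  shows "half_open_cone_euler V p F A = 0"
  using assms(5)
proof (induction "card (V \<times> V - F\<^sup>*)" arbitrary: F rule: less_induct)
  case less
  show ?case
  proof (cases "\<exists>x \<in> V. \<exists>y \<in> V. (x, y) \<notin> F\<^sup>* \<and> (y, x) \<notin> F\<^sup>*")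
    case True
    then obtain x y where xy: "x \<in> V" "y \<in> V" "(x, y) \<notin> F\<^sup>*" "(y, x) \<notin> F\<^sup>*" by blast
    have IH: "half_open_cone_euler V p G A = 0"
      if G: "F \<subseteq> G" and new: "(x, y) \<in> G \<or> (y, x) \<in> G" for G
    proof (rule less.hyps)
      have "F\<^sup>* \<subseteq> G\<^sup>*" using G by (rule rtrancl_mono)
      then have "V \<times> V - G\<^sup>* \<subset> V \<times> V - F\<^sup>*" using new xy by blast
      then show "card (V \<times> V - G\<^sup>*) < card (V \<times> V - F\<^sup>*)"
        using assms(1) by (simp add: psubset_card_mono)
      show "(u, v) \<in> (G \<union> (p ` A)\<inverse>)\<^sup>*"
        using less.prems rtrancl_mono[of "F \<union> (p ` A)\<inverse>" "G \<union> (p ` A)\<inverse>"] G by blast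
    qed
    have "half_open_cone_euler V p (insert (x, y) (insert (y, x) F)) A = 0"
      "half_open_cone_euler V p (insert (x, y) F) A = 0"
      "half_open_cone_euler V p (insert (y, x) F) A = 0"
      by (rule IH; blast)+
    then show ?thesis using half_open_cone_euler_four_term[OF assms(1) xy(1,2), of p F A] by simp
  next
    case False
    then have "p ` A \<inter> F\<^sup>* \<noteq> {}"
      using assms(3,4) less.prems by (intro total_rtrancl_meets_if_infeasible[of _ V _ u v]) auto
    then show ?thesis using half_open_cone_euler_eq_0_if_implied[OF assms(2)] by blast
  qed
qed

lemma half_open_cone_euler_totally_cyclic:
  assumes "finite V" "finite C" "p ` C \<subseteq> V \<times> V" "Z \<subset> C"
    and "sym ((p ` Z)\<^sup>*)" "sym ((p ` C)\<^sup>*)"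
  shows "half_open_cone_euler V p (p ` Z) (C - Z) = 0"
proof -
  let ?R = "p ` Z \<union> (p ` (C - Z))\<inverse>"
  obtain e where e: "e \<in> C - Z" using assms(4) by blast
  obtain u v where uv: "p e = (u, v)" by fastforce
  have in_A: "(u, v) \<in> p ` (C - Z)" using e uv by (simp add: rev_image_eqI)
  then have "(u, v) \<in> (p ` C)\<^sup>*" by auto
  then have "(u, v) \<in> ((p ` C)\<inverse>)\<^sup>*" using assms(6) by (simp add: rtrancl_converse symD)
  moreover have "(p ` C)\<inverse> \<subseteq> ?R\<^sup>*"
  proof -
    have "(p ` C)\<inverse> = (p ` Z)\<inverse> \<union> (p ` (C - Z))\<inverse>" using assms(4) by blast
    moreover have "(p ` Z)\<inverse> \<subseteq> ?R\<^sup>*"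
      using assms(5) rtrancl_mono[of "p ` Z" ?R] unfolding sym_rtrancl_iff by blast
    ultimately show ?thesis by blast
  qed
  then have "((p ` C)\<inverse>)\<^sup>* \<subseteq> ?R\<^sup>*" by (rule rtrancl_subset_rtrancl)
  ultimately have "(u, v) \<in> ?R\<^sup>*" by blast
  then show ?thesis
    using assms(1-3) by (intro half_open_cone_euler_eq_0_if_infeasible[OF _ _ _ in_A]) auto
qed

definition cone_sign :: "'v set \<Rightarrow> ('b \<Rightarrow> 'v \<times> 'v) \<Rightarrow> 'b set \<Rightarrow> int" where
  "cone_sign V p B = (-1) ^ card B * cone_euler V (p ` B)"

lemma sum_cone_sign_interval:
  assumes "finite V" "finite C" "p ` C \<subseteq> V \<times> V" "Z \<subset> C"
    and "sym ((p ` Z)\<^sup>*)" "sym ((p ` C)\<^sup>*)"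
  shows "(\<Sum>B | Z \<subseteq> B \<and> B \<subseteq> C. cone_sign V p B) = 0"
proof -
  have fin_Z: "finite Z" using assms(2,4) finite_subset by blast
  have "(\<Sum>B | Z \<subseteq> B \<and> B \<subseteq> C. cone_sign V p B) =
      (\<Sum>X \<in> Pow (C - Z). (-1) ^ card Z * ((-1) ^ card X * cone_euler V (p ` X \<union> p ` Z)))"
  proof (rule sum.reindex_bij_witness[where i = "\<lambda>X. X \<union> Z" and j = "\<lambda>B. B - Z"])
    fix B assume B: "B \<in> {B. Z \<subseteq> B \<and> B \<subseteq> C}"
    then have "p ` (B - Z) \<union> p ` Z = p ` B" by blast
    moreover have "card B = card Z + card (B - Z)"
      using B assms(2) fin_Z card_mono[of B Z] finite_subset[of B C] by (simp add: card_Diff_subset)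
    ultimately show "(-1) ^ card Z * ((-1) ^ card (B - Z) * cone_euler V (p ` (B - Z) \<union> p ` Z)) =
        cone_sign V p B"
      by (simp add: cone_sign_def power_add)
  qed (use assms(4) in auto)
  also have "\<dots> = (-1) ^ card Z * half_open_cone_euler V p (p ` Z) (C - Z)"
    by (simp add: half_open_cone_euler_def sum_distrib_left)
  also have "half_open_cone_euler V p (p ` Z) (C - Z) = 0"
    by (rule half_open_cone_euler_totally_cyclic[OF assms])
  finally show ?thesis by simp
qed

lemma eulerian_sign_cone_sign:
  assumes "finite V" "finite A" "p ` A \<subseteq> V \<times> V"
  shows "eulerian_sign {B. B \<subseteq> A \<and> sym ((p ` B)\<^sup>*)} (cone_sign V p)"
    (is "eulerian_sign ?Q _")
  unfolding eulerian_sign_def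
proof (intro conjI ballI impI)
  fix B assume "B \<in> ?Q"
  then show "cone_sign V p B * cone_sign V p B = 1"
    by (simp add: cone_sign_def cone_euler_def flip: power_add mult_2)
next
  fix Z C
  assume Z: "Z \<in> ?Q" and C: "C \<in> ?Q" and "Z \<subset> C"
  have fin: "finite C" "p ` C \<subseteq> V \<times> V" using C assms(2,3) finite_subset by blast+
  have "(\<Sum>B \<in> {B \<in> ?Q. Z \<subseteq> B \<and> B \<subseteq> C}. cone_sign V p B) =
      (\<Sum>B | Z \<subseteq> B \<and> B \<subseteq> C. cone_sign V p B)"
    by (rule sum.mono_neutral_left)
      (use fin C in \<open>auto simp: cone_sign_def cone_euler_def intro: finite_subset[of _ "Pow C"]\<close>)
  also have "\<dots> = 0" using Z C by (intro sum_cone_sign_interval assms(1) fin \<open>Z \<subset> C\<close>) auto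
  finally show "(\<Sum>B \<in> {B \<in> ?Q. Z \<subseteq> B \<and> B \<subseteq> C}. cone_sign V p B) = 0" .
qed

section \<open>Totally cyclic arc sets\<close>

lemma (in fin_digraph) max_subgraph_exists:
  assumes "subgraph H G" "P H"
  shows "\<exists>M. max_subgraph P M \<and> subgraph H M"
  using assms
proof (induction "card ((verts G <+> arcs G) - (verts H <+> arcs H))" arbitrary: H
    rule: less_induct)
  case less
  let ?missing = "\<lambda>H. (verts G <+> arcs G) - (verts H <+> arcs H)"
  show ?case
  proof (cases "max_subgraph P H")
    case True
    moreover have "subgraph H H" using less.prems(1) by (auto simp: wf_digraph.subgraph_refl)
    ultimately show ?thesis by blast
  next
    case False
    then obtain H' where H': "H' \<noteq> H" "subgraph H H'" "subgraph H' G" "P H'"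
      using less.prems by (auto simp: max_subgraph_def)
    then have "verts H \<noteq> verts H' \<or> arcs H \<noteq> arcs H'"
      by (auto simp: subgraph_def compatible_def intro: pre_digraph.equality)
    then have "?missing H' \<subset> ?missing H"
      using H'(2,3) by (fastforce simp: subgraph_def)
    then have "card (?missing H') < card (?missing H)"
      by (simp add: psubset_card_mono)
    then obtain M where "max_subgraph P M" "subgraph H' M"
      using less.hyps[OF _ H'(3,4)] by blast
    then show ?thesis using H'(2) subgraph_trans by blast
  qed
qed

lemma (in wf_digraph) reachable_mk_symmetric_eq_if_sym_rtrancl:
  assumes "sym ((arcs_ends G)\<^sup>*)"
  shows "u \<rightarrow>\<^sup>*\<^bsub>mk_symmetric G\<^esub> v \<longleftrightarrow> u \<rightarrow>\<^sup>* v"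
proof
  interpret S: pair_wf_digraph "mk_symmetric G" ..
  assume "u \<rightarrow>\<^sup>*\<^bsub>mk_symmetric G\<^esub> v"
  moreover have "arcs_ends (mk_symmetric G) \<subseteq> (arcs_ends G)\<^sup>*"
    using assms unfolding sym_rtrancl_iff by (auto simp: parcs_mk_symmetric arcs_ends_conv)
  ultimately show "u \<rightarrow>\<^sup>* v"
    using rtrancl_subset_rtrancl by (auto simp: reachable_conv S.reachable_conv)
qed (rule reachable_mk_symmetricI)

lemma (in wf_digraph) strongly_connected_imp_connected:
  "strongly_connected G \<Longrightarrow> connected G"
  by (rule connectedI) (auto simp: strongly_connected_def intro: reachable_mk_symmetricI)

lemma (in wf_digraph) weak_component_strongly_connected_if_sym_rtrancl:
  assumes "sym ((arcs_ends G)\<^sup>*)" "H \<in> weak_components G"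
  shows "strongly_connected H"
proof -
  have max: "max_subgraph connected H" using assms(2) by (simp add: weak_components_def)
  then have sub: "subgraph H G" and con: "connected H" by (simp_all add: max_subgraph_def)
  then obtain u where u: "u \<in> verts H" "u \<in> verts G"
    by (auto simp: connected_def strongly_connected_def)
  have reach: "v \<rightarrow>\<^sup>* w" if "v \<in> verts H" "w \<in> verts H" for v w
  proof -
    have "v \<rightarrow>\<^sup>*\<^bsub>mk_symmetric H\<^esub> w" using con that by (auto simp: connected_def)
    then have "v \<rightarrow>\<^sup>*\<^bsub>mk_symmetric G\<^esub> w"
      by (rule pre_digraph.reachable_mono) (rule subgraph_mk_symmetric[OF sub])
    then show ?thesis using reachable_mk_symmetric_eq_if_sym_rtrancl[OF assms(1)] by simp
  qed
  let ?S = "G \<restriction> scc_of u"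
  have scc: "?S \<in> sccs" using u(2) by (simp add: in_verts_sccsD_sccs scc_of_in_sccs_verts)
  then have S: "subgraph ?S G" "strongly_connected ?S"
    by (auto simp: in_sccs_imp_induced induced_imp_subgraph)
  then interpret S: wf_digraph ?S by (simp add: subgraph_def)
  have "verts H \<subseteq> scc_of u" using reach u(1) by (auto simp: scc_of_def)
  then have "subgraph H ?S"
    using sub S(1) wf_digraph.wellformed[of H] by (auto simp: subgraph_def compatible_def)
  then have "H = ?S"
    using max S S.strongly_connected_imp_connected by (auto simp: max_subgraph_def)
  then show ?thesis using S(2) by simp
qed

lemma (in fin_digraph) arc_in_weak_component:
  assumes "e \<in> arcs G"
  shows "\<exists>H \<in> weak_components G. e \<in> arcs H"
proof -
  let ?H = "G \<restriction> {tail G e, head G e}"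
  have sub: "subgraph ?H G" using assms by (intro subgraph_induce_subgraphI) auto
  interpret H: wf_digraph ?H by rule
  interpret S: pair_wf_digraph "mk_symmetric ?H" by (rule H.wellformed_mk_symmetric)
  have "connected ?H"
  proof (rule H.connectedI)
    have "(tail G e, head G e) \<in> parcs (mk_symmetric ?H)"
      "(head G e, tail G e) \<in> parcs (mk_symmetric ?H)"
      using assms by (auto simp: parcs_mk_symmetric)
    then show "u \<rightarrow>\<^sup>*\<^bsub>mk_symmetric ?H\<^esub> v" if "u \<in> verts ?H" "v \<in> verts ?H" for u v
      using that by (auto intro: S.reachable_adjI)
  qed simp
  then obtain M where "max_subgraph connected M" "subgraph ?H M"
    using max_subgraph_exists[OF sub] by blast
  moreover have "e \<in> arcs ?H" using assms by simp
  ultimately show ?thesis unfolding weak_components_def by (blast elim: subgraphE)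
qed

lemma (in fin_digraph) totally_cyclic_iff: "totally_cyclic G \<longleftrightarrow> sym ((arcs_ends G)\<^sup>*)"
proof
  assume tc: "totally_cyclic G"
  show "sym ((arcs_ends G)\<^sup>*)"
    unfolding sym_rtrancl_iff
  proof (rule subrelI)
    fix v u assume "(v, u) \<in> (arcs_ends G)\<inverse>"
    then obtain e where e: "e \<in> arcs G" "tail G e = u" "head G e = v" by (auto simp: arcs_ends_conv)
    obtain H where H: "H \<in> weak_components G" "e \<in> arcs H"
      using arc_in_weak_component[OF e(1)] by blast
    then have sub: "subgraph H G" by (simp add: weak_components_def max_subgraph_def)
    then have "u \<in> verts H" "v \<in> verts H"
      using H(2) e wf_digraph.wellformed[of H e] by (auto simp: subgraph_def compatible_def)
    then have "v \<rightarrow>\<^sup>*\<^bsub>H\<^esub> u" using tc H(1) by (auto simp: totally_cyclic_def)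
    then show "(v, u) \<in> (arcs_ends G)\<^sup>*" using sub by (intro reachable_rtranclI reachable_mono)
  qed
qed (auto simp: totally_cyclic_def intro: weak_component_strongly_connected_if_sym_rtrancl)

lemma totally_cyclic_sets_eq:
  assumes "fin_digraph D"
  shows "totally_cyclic_sets D = {B. B \<subseteq> arcs D \<and> sym ((arc_to_ends D ` B)\<^sup>*)}"
proof -
  interpret fin_digraph D by fact
  have "totally_cyclic (arc_subdigraph D B) \<longleftrightarrow> sym ((arc_to_ends D ` B)\<^sup>*)" if "B \<subseteq> arcs D" for B
  proof -
    interpret S: fin_digraph "arc_subdigraph D B"
      using finite_subset[OF that finite_arcs] by unfold_locales (auto simp: arc_subdigraph_def)
    have "arcs_ends (arc_subdigraph D B) = arc_to_ends D ` B"
      by (simp add: arcs_ends_def arc_to_ends_def arc_subdigraph_def)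
    then show ?thesis by (simp add: S.totally_cyclic_iff)
  qed
  then show ?thesis by (auto simp: totally_cyclic_sets_def)
qed

lemma (in pre_digraph) cas_imp_rtrancl:
  "cas u p v \<Longrightarrow> (u, v) \<in> (arc_to_ends G ` set p)\<^sup>*"
proof (induction p arbitrary: u)
  case (Cons e p)
  then have "(head G e, v) \<in> (arc_to_ends G ` set p)\<^sup>*" and u: "tail G e = u" by auto
  then have "(head G e, v) \<in> (arc_to_ends G ` set (e # p))\<^sup>*"
    using rtrancl_mono[of "arc_to_ends G ` set p" "arc_to_ends G ` set (e # p)"] by auto
  moreover have "(u, head G e) \<in> arc_to_ends G ` set (e # p)" using u by (simp add: arc_to_ends_def)
  ultimately show ?case by (rule converse_rtrancl_into_rtrancl[rotated])
qed simp

lemma (in pre_digraph) cycle_imp_sym_rtrancl: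
  assumes "cycle p"
  shows "sym ((arc_to_ends G ` set p)\<^sup>*)"
  unfolding sym_rtrancl_iff
proof (rule subrelI)
  let ?R = "arc_to_ends G ` set p"
  fix y x assume "(y, x) \<in> ?R\<inverse>"
  then obtain e where e: "e \<in> set p" "x = tail G e" "y = head G e" by (auto simp: arc_to_ends_def)
  obtain u where "cas u p u" using assms by (auto simp: cycle_def awalk_def)
  moreover obtain q r where p: "p = q @ e # r" using e(1) by (auto simp: in_set_conv_decomp)
  ultimately have "(u, x) \<in> (arc_to_ends G ` set q)\<^sup>*" "(y, u) \<in> (arc_to_ends G ` set r)\<^sup>*"
    using e cas_imp_rtrancl by auto
  moreover have "(arc_to_ends G ` set q)\<^sup>* \<subseteq> ?R\<^sup>*" "(arc_to_ends G ` set r)\<^sup>* \<subseteq> ?R\<^sup>*"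
    unfolding p by (auto intro!: rtrancl_mono)
  ultimately show "(y, x) \<in> ?R\<^sup>*" by (blast intro: rtrancl_trans)
qed

lemma (in wf_digraph) cycle_through_arc:
  assumes "C \<subseteq> arcs G" "sym ((arc_to_ends G ` C)\<^sup>*)" "e \<in> C"
  shows "\<exists>p. cycle p \<and> e \<in> set p \<and> set p \<subseteq> C"
proof -
  let ?H = "G\<lparr>arcs := C\<rparr>"
  interpret H: wf_digraph ?H using assms(1) by unfold_locales auto
  have comp: "compatible G ?H" by (simp add: compatible_def)
  have "(tail G e, head G e) \<in> (arc_to_ends G ` C)\<^sup>*"
    using assms(3) by (auto simp: arc_to_ends_def)
  then have "(head G e, tail G e) \<in> (arcs_ends ?H)\<^sup>*"
    using symD[OF assms(2)] by (simp add: arcs_ends_def arc_to_ends_def)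
  moreover have "head G e \<in> verts ?H" using assms(1,3) by auto
  ultimately obtain p where p: "H.apath (head G e) p (tail G e)"
    using H.reachable_conv' H.reachable_apath by blast
  then have "cas (head G e) p (tail G e)" "distinct (awalk_verts (head G e) p)" and set: "set p \<subseteq> C"
    unfolding H.apath_def H.awalk_def compatible_cas[OF comp] compatible_awalk_verts[OF comp]
    by auto
  then have "cycle (e # p)"
    using assms(1,3) by (auto simp: cycle_def awalk_def)
  then show ?thesis using set assms(3) by (intro exI[of _ "e # p"]) auto
qed

lemma cycle_unions_eq_totally_cyclic_sets:
  assumes "fin_digraph D"
  shows "cycle_unions D = totally_cyclic_sets D"
proof (intro equalityI subsetI)
  interpret fin_digraph D by fact
  fix C assume C: "C \<in> cycle_unions D"
  then obtain S where S: "C = \<Union> (set ` S)" "\<forall>p \<in> S. cycle p" by (auto simp: cycle_unions_def)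
  have "sym ((\<Union>p \<in> S. arc_to_ends D ` set p)\<^sup>*)"
    by (rule sym_rtrancl_Union) (use S(2) cycle_imp_sym_rtrancl in auto)
  then show "C \<in> totally_cyclic_sets D"
    using cycle_unions_subset[OF C] S(1) by (simp add: totally_cyclic_sets_eq[OF assms] image_UN)
next
  interpret fin_digraph D by fact
  fix C assume "C \<in> totally_cyclic_sets D"
  then have C: "C \<subseteq> arcs D" "sym ((arc_to_ends D ` C)\<^sup>*)"
    by (simp_all add: totally_cyclic_sets_eq[OF assms])
  obtain f where f: "\<forall>e \<in> C. cycle (f e) \<and> e \<in> set (f e) \<and> set (f e) \<subseteq> C"
    using cycle_through_arc[OF C] by metis
  then have "C = \<Union> (set ` (f ` C))" by auto
  moreover have "finite C" using C(1) finite_arcs by (rule finite_subset)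
  ultimately show "C \<in> cycle_unions D"
    unfolding cycle_unions_def using f by (intro CollectI exI[of _ "f ` C"]) auto
qed

section \<open>The Moebius function and the rank\<close>

lemma moebius_cycle_contractions:
  assumes "fin_digraph D" "eulerian_sign (cycle_unions D) s"
    and "Z \<in> cycle_unions D" "C \<in> cycle_unions D" "Z \<subseteq> C"
  shows "moebius (cycle_contractions D) (cycle_contraction_order D) (contract D C) (contract D Z) =
    s C * s Z"
proof -
  let ?U = "cycle_unions D" and ?P = "cycle_contractions D" and ?le = "cycle_contraction_order D"
  define sign where "sign Y = s (arcs D - arcs Y)" for Y :: "('a set, 'b) pre_digraph"
  have sign: "sign (contract D B) = s B" if "B \<in> ?U" for B
    using cycle_unions_subset[OF that] by (simp add: sign_def contract_def double_diff)
  have le: "(contract D X, contract D Y) \<in> ?le \<longleftrightarrow> Y \<subseteq> X" if "X \<in> ?U" "Y \<in> ?U" for X Y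
    unfolding cycle_contraction_order_def using that inj_onD[OF inj_on_contract[of D]] by blast
  have "(\<Sum>y \<in> {y \<in> ?P. (a, y) \<in> ?le \<and> (y, b) \<in> ?le}. sign y) = 0"
    if ab: "(a, b) \<in> ?le" "a \<noteq> b" for a b
  proof -
    obtain X Y where XY: "a = contract D X" "b = contract D Y" "X \<in> ?U" "Y \<in> ?U" "Y \<subset> X"
      using ab unfolding cycle_contraction_order_def by blast
    let ?I = "{B \<in> ?U. Y \<subseteq> B \<and> B \<subseteq> X}"
    have "{y \<in> ?P. (a, y) \<in> ?le \<and> (y, b) \<in> ?le} = contract D ` ?I"
      using le XY(3,4) unfolding XY(1,2) cycle_contractions_def by blast
    moreover have "inj_on (contract D) ?I"
      using inj_on_contract by (rule inj_on_subset) auto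
    ultimately have "(\<Sum>y \<in> {y \<in> ?P. (a, y) \<in> ?le \<and> (y, b) \<in> ?le}. sign y) = (\<Sum>B \<in> ?I. s B)"
      using sign by (simp add: sum.reindex)
    then show ?thesis using assms(2) XY(3-5) by (simp add: eulerian_sign_def)
  qed
  moreover have "sign y * sign y = 1" if "y \<in> ?P" for y
    using that sign assms(2) by (auto simp: cycle_contractions_def eulerian_sign_def)
  moreover have "(contract D C, contract D Z) \<in> ?le" using le assms(3-5) by simp
  ultimately have "moebius ?P ?le (contract D C) (contract D Z) =
      sign (contract D C) * sign (contract D Z)"
    using finite_cycle_contractions[OF assms(1)] partial_order_on_cycle_contractions
    by (intro moebius_eq_sign_mult)
  then show ?thesis using sign assms(3,4) by simp
qed

lemma eulerian_sign_rk_Q: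
  assumes "fin_digraph D" "eulerian_sign (totally_cyclic_sets D) s" "B \<in> totally_cyclic_sets D"
  shows "s B = (-1) ^ rk_Q D B * s {}"
proof -
  interpret fin_digraph D by fact
  let ?Q = "totally_cyclic_sets D"
  let ?R = "{r. \<exists>c. c 0 = {} \<and> c r = B \<and> set_chain ?Q r c}"
  have rk: "rk_Q D B = Max ?R" by (simp add: rk_Q_def set_chain_def)
  have "finite B"
    using assms(3) finite_arcs by (auto simp: totally_cyclic_sets_def intro: finite_subset)
  then have fin: "finite ?R"
    by (intro finite_subset[of ?R "{..card B}"]) (auto dest: set_chain_length_le_card)
  have "{} \<in> ?Q"
    using empty_in_cycle_unions[of D]
    by (simp add: cycle_unions_eq_totally_cyclic_sets[OF assms(1)])
  then have "set_chain ?Q (of_bool (B \<noteq> {})) (\<lambda>i. if i = 0 then {} else B)"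
    using assms(3) by (auto simp: set_chain_def)
  then have "?R \<noteq> {}" by force
  then have "rk_Q D B \<in> ?R" unfolding rk by (rule Max_in[OF fin])
  then obtain c where c: "c 0 = {}" "c (rk_Q D B) = B" "set_chain ?Q (rk_Q D B) c" by blast
  have "s (c (rk_Q D B)) = (-1) ^ rk_Q D B * s (c 0)"
  proof (rule eulerian_sign_longest_chain[OF assms(2) c(3)])
    fix d k assume "set_chain ?Q k d" "d 0 = c 0" "d k = c (rk_Q D B)"
    then have "k \<in> ?R" using c(1,2) by auto
    then show "k \<le> rk_Q D B" unfolding rk by (rule Max_ge[OF fin])
  qed
  then show ?thesis by (simp add: c(1,2))
qed

lemma eulerian_sign_totally_cyclic_sets:
  assumes "fin_digraph D"
  shows "eulerian_sign (totally_cyclic_sets D) (cone_sign (verts D) (arc_to_ends D))"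
proof -
  interpret fin_digraph D by fact
  have "arc_to_ends D ` arcs D \<subseteq> verts D \<times> verts D" by (auto simp: arc_to_ends_def)
  then show ?thesis
    unfolding totally_cyclic_sets_eq[OF assms]
    by (rule eulerian_sign_cone_sign[OF finite_verts finite_arcs])
qed

lemma moebius_contract_eq_sign_rk_Q:
  assumes "fin_digraph D" "B \<in> cycle_unions D"
  shows "moebius (cycle_contractions D) (cycle_contraction_order D) (contract D B) (contract D {}) =
    (-1) ^ rk_Q D B"
proof -
  let ?s = "cone_sign (verts D) (arc_to_ends D)"
  note sign = eulerian_sign_totally_cyclic_sets[OF assms(1)]
  note QU = cycle_unions_eq_totally_cyclic_sets[OF assms(1)]
  have "moebius (cycle_contractions D) (cycle_contraction_order D) (contract D B) (contract D {}) =
      ?s B * ?s {}"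
    using sign assms empty_in_cycle_unions[of D]
    by (intro moebius_cycle_contractions) (auto simp: QU)
  also have "\<dots> = (-1) ^ rk_Q D B * (?s {} * ?s {})"
    using eulerian_sign_rk_Q[OF assms(1) sign] assms(2) by (simp add: QU)
  also have "?s {} * ?s {} = 1"
    using sign empty_in_cycle_unions[of D] unfolding QU eulerian_sign_def by blast
  finally show ?thesis by simp
qed

theorem theorem3p4:
  fixes D :: "('a, 'b) pre_digraph"
  assumes "fin_digraph D"
  shows "psi_NL D =
    (\<Sum>B \<in> totally_cyclic_sets D. monom ((-1) ^ rk_Q D B) (digraph_rk (contract D B)))"
proof -
  let ?\<mu> = "moebius (cycle_contractions D) (cycle_contraction_order D)"
  have "psi_NL D =
      (\<Sum>B \<in> cycle_unions D. monom (?\<mu> (contract D B) (contract D {})) (digraph_rk (contract D B)))"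
    unfolding psi_NL_def cycle_contractions_def
    by (simp add: sum.reindex[OF inj_on_contract])
  also have "\<dots> = (\<Sum>B \<in> cycle_unions D. monom ((-1) ^ rk_Q D B) (digraph_rk (contract D B)))"
    by (simp add: moebius_contract_eq_sign_rk_Q[OF assms])
  finally show ?thesis by (simp add: cycle_unions_eq_totally_cyclic_sets[OF assms])
qed

end
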